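(* For every instance of the TSP-mD with $m$ drones, $$\text{m-CYCLE}\;\le\;(1+2m)\,\text{TSP-mD}.$$ If, moreover, every feasible sortie of the instance either is a loop or contains (serves) only one customer, then $$\text{m-CYCLE}\;\le\;(1+m)\,\text{TSP-mD}.$$
   Context: Instance. An instance of the TSP-mD (Traveling Salesman Problem with Drones) consists of a finite set $N$ of nodes with a depot $0\in N$; the complete directed graph with arc set $A=\{(i,j)\in N\times N: i\neq j\}$; subsets $N^{tr},N^{dr}\subseteq N$ (nodes that can be served by the truck, resp. by the drones) with $N^{tr}\cup N^{dr}=N$ and $0\in N^{tr}$; two metrics $\ell,\ell'$ on $N$ ($\ell_{ij}$, resp. $\ell'_{ij}$, is the time the truck, resp. a drone, needs to traverse $(i,j)$); a number $m\ge 1$ of identical drones; a drone weight $w^{dr}>0$; payloads $w_i\ge 0$ for $i\in N^{dr}$; and a battery capacity $B>0$. Sorties. A sortie is a tuple $\pi=(i_1,\dots,i_r)$, $r\ge 3$, with $i_1,i_r\in N^{tr}$, $i_2,\dots,i_{r-1}\in N^{dr}$ and consecutive nodes distinct. It is a loop if $i_1=i_r$. It serves the nodes $N[\pi]=\{i_2,\dots,i_{r-1}\}$ and has duration $\ell'_\pi=\sum_{q=1}^{r-1}\ell'_{i_qi_{q+1}}$. Its energy consumption is $w^{dr}\sum_{q=1}^{r-1}\ell'_{i_qi_{q+1}}+\sum_{p=2}^{r-1}\bigl(w_{i_p}\sum_{q=1}^{p-1}\ell'_{i_qi_{q+1}}\bigr)$, and it is feasible if this is at most $B$. Solutions. A (feasible)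 solution consists of a truck route, which is a closed walk $0=v_0,v_1,\dots,v_n=0$ with all $v_t\in N^{tr}$ and consecutive nodes distinct (nodes and arcs may be repeated), and a finite family of feasible sorties, each assigned to a drone and to a pair of visit indices $s\le e$ such that the sortie starts at $v_s$ (launch from the truck at its visit number $s$) and ends at $v_e$ (retrieval by the truck at visit number $e$). The sorties of the same drone are performed one after the other (each one is launched at or after the visit at which the previous one was retrieved, and after that retrieval). Every node of $N$ must be on the truck route or served by some sortie. The truck starts at time $0$; it may wait at nodes, a drone may wait at its landing node for the truck, a sortie with duration $\ell'_\pi$ launched while the truck is at visit $s$ lands $\ell'_\pi$ time units after launch, and the truck may not leave visit $e$ before the drone has landed. Launching, retrieving, serving and battery swapping take no time. The completion time is the earliest time at which the truck has completed its route and all drones have been retrieved at the depot or earlier; it is to be minimized over all solutions. Only instances admitting at least one feasible solution are considered. For an instance, TSP-mD also denotes the minimum completion time over all solutions, and m-CYCLE denotes the minimum completion time over all solutions whose truck route does not revisit nodes (i.e. $v_0,\dots,v_{n-1}$ are pairwise distinct; the depot occurs only as start and end). *)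

theory Defs
  imports "HOL-Analysis.Abstract_Metric_Spaces"
begin

section \<open>Instances\<close>

record 'a tspd =
  nodes        :: "'a set"
  depot        :: 'a
  truck_nodes  :: "'a set"
  drone_nodes  :: "'a set"
  truck_time   :: "'a \<Rightarrow> 'a \<Rightarrow> real"
  drone_time   :: "'a \<Rightarrow> 'a \<Rightarrow> real"
  drones       :: nat
  drone_weight :: real
  payload      :: "'a \<Rightarrow> real"
  battery      :: real

text \<open>The arc set is left implicit: the digraph is complete, so walking along arcs means that
  consecutive nodes are distinct (\<^const>\<open>distinct_adj\<close>).\<close>

definition tspd_instance :: "'a tspd \<Rightarrow> bool" where
  "tspd_instance I \<longleftrightarrow>
     finite (nodes I) \<and> depot I \<in> nodes I \<and>
     truck_nodes I \<subseteq> nodes I \<and> drone_nodes I \<subseteq> nodes I \<and>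
     truck_nodes I \<union> drone_nodes I = nodes I \<and> depot I \<in> truck_nodes I \<and>
     Metric_space (nodes I) (truck_time I) \<and> Metric_space (nodes I) (drone_time I) \<and>
     1 \<le> drones I \<and> 0 < drone_weight I \<and>
     (\<forall>i \<in> drone_nodes I. 0 \<le> payload I i) \<and> 0 < battery I"


section \<open>Sorties\<close>

text \<open>A sortie is the list of its nodes, indexed from 0 rather than from 1.\<close>

definition served :: "'a list \<Rightarrow> 'a set" where
  "served p = set (butlast (tl p))"

definition sortie :: "'a tspd \<Rightarrow> 'a list \<Rightarrow> bool" where
  "sortie I p \<longleftrightarrow>
     3 \<le> length p \<and> hd p \<in> truck_nodes I \<and> last p \<in> truck_nodes I \<and>
     served p \<subseteq> drone_nodes I \<and> distinct_adj p"

definition is_loop :: "'a list \<Rightarrow> bool" where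
  "is_loop p \<longleftrightarrow> hd p = last p"

definition sortie_duration :: "'a tspd \<Rightarrow> 'a list \<Rightarrow> real" where
  "sortie_duration I p = (\<Sum>q<length p - 1. drone_time I (p ! q) (p ! Suc q))"

text \<open>Each payload is carried from the launch until its node is reached.\<close>

definition sortie_energy :: "'a tspd \<Rightarrow> 'a list \<Rightarrow> real" where
  "sortie_energy I p =
     drone_weight I * (\<Sum>q<length p - 1. drone_time I (p ! q) (p ! Suc q)) +
     (\<Sum>k = 1..<length p - 1. payload I (p ! k) * (\<Sum>q<k. drone_time I (p ! q) (p ! Suc q)))"

definition feasible_sortie :: "'a tspd \<Rightarrow> 'a list \<Rightarrow> bool" where
  "feasible_sortie I p \<longleftrightarrow> sortie I p \<and> sortie_energy I p \<le> battery I"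


section \<open>Solutions\<close>

text \<open>A flight is a sortie together with its launch and retrieval visits (positions on the truck
  route).\<close>

record 'a flight =
  tour           :: "'a list"
  launch_visit   :: nat
  retrieve_visit :: nat

text \<open>The entry \<open>flights S ! d\<close> lists the flights of drone \<open>d\<close> in the order in which they are
  performed.\<close>

record 'a solution =
  route   :: "'a list"
  flights :: "'a flight list list"

text \<open>The route \<open>[depot]\<close>, on which the truck stays at the depot, is admitted.\<close>

definition truck_route :: "'a tspd \<Rightarrow> 'a list \<Rightarrow> bool" where
  "truck_route I vs \<longleftrightarrow>
     vs \<noteq> [] \<and> hd vs = depot I \<and> last vs = depot I \<and> set vs \<subseteq> truck_nodes I \<and> distinct_adj vs"

definition feasible_flight :: "'a tspd \<Rightarrow> 'a list \<Rightarrow> 'a flight \<Rightarrow> bool" where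
  "feasible_flight I vs f \<longleftrightarrow>
     feasible_sortie I (tour f) \<and>
     launch_visit f \<le> retrieve_visit f \<and> retrieve_visit f < length vs \<and>
     hd (tour f) = vs ! launch_visit f \<and> last (tour f) = vs ! retrieve_visit f"

definition feasible_solution :: "'a tspd \<Rightarrow> 'a solution \<Rightarrow> bool" where
  "feasible_solution I S \<longleftrightarrow>
     truck_route I (route S) \<and>
     length (flights S) = drones I \<and>
     (\<forall>F \<in> set (flights S).
        (\<forall>f \<in> set F. feasible_flight I (route S) f) \<and>
        (\<forall>j. Suc j < length F \<longrightarrow> retrieve_visit (F ! j) \<le> launch_visit (F ! Suc j))) \<and>
     nodes I \<subseteq> set (route S) \<union> (\<Union>F \<in> set (flights S). \<Union>f \<in> set F. served (tour f))"

definition no_revisit :: "'a solution \<Rightarrow> bool" where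
  "no_revisit S \<longleftrightarrow> distinct (butlast (route S))"


section \<open>Completion times\<close>

text \<open>The truck is at its visit \<open>t\<close> during \<open>[arr t, dep t]\<close>; the \<open>j\<close>-th flight of drone \<open>d\<close> is
  launched from the truck at time \<open>lau d j\<close> and taken back onto the truck at time \<open>ret d j\<close>.
  Waiting of the truck is \<open>arr t < dep t\<close>; a drone that has landed at time
  \<open>lau d j + sortie_duration I (tour f)\<close> may wait until \<open>ret d j\<close>.\<close>

definition schedule ::
  "'a tspd \<Rightarrow> 'a solution \<Rightarrow> (nat \<Rightarrow> real) \<Rightarrow> (nat \<Rightarrow> real) \<Rightarrow>
     (nat \<Rightarrow> nat \<Rightarrow> real) \<Rightarrow> (nat \<Rightarrow> nat \<Rightarrow> real) \<Rightarrow> bool" where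
  "schedule I S arr dep lau ret \<longleftrightarrow>
     arr 0 = 0 \<and>
     (\<forall>t < length (route S). arr t \<le> dep t) \<and>
     (\<forall>t. Suc t < length (route S) \<longrightarrow>
        arr (Suc t) = dep t + truck_time I (route S ! t) (route S ! Suc t)) \<and>
     (\<forall>d < length (flights S). \<forall>j < length (flights S ! d).
        let f = flights S ! d ! j in
          arr (launch_visit f) \<le> lau d j \<and> lau d j \<le> dep (launch_visit f) \<and>
          lau d j + sortie_duration I (tour f) \<le> ret d j \<and>
          arr (retrieve_visit f) \<le> ret d j \<and> ret d j \<le> dep (retrieve_visit f)) \<and>
     (\<forall>d < length (flights S). \<forall>j. Suc j < length (flights S ! d) \<longrightarrow> ret d j \<le> lau d (Suc j))"

text \<open>The departure from the last visit stands for the end of the operation: every flight is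
  retrieved at a visit of the route, so by then the truck is back at the depot carrying all drones.
  The earliest such time is a minimum, as all constraints of a schedule are bounds from below on
  differences of times and hence preserved by pointwise infima.\<close>

definition completion_time :: "'a tspd \<Rightarrow> 'a solution \<Rightarrow> real" where
  "completion_time I S =
     Inf {dep (length (route S) - 1) | arr dep lau ret. schedule I S arr dep lau ret}"

text \<open>Both infima are minima if there is a solution: all arcs have positive durations, hence for
  each bound \<open>C\<close> only finitely many solutions have completion time at most \<open>C\<close>.\<close>

definition TSP_mD :: "'a tspd \<Rightarrow> real" where
  "TSP_mD I = Inf (completion_time I ` {S. feasible_solution I S})"

definition m_CYCLE :: "'a tspd \<Rightarrow> real" where
  "m_CYCLE I = Inf (completion_time I ` {S. feasible_solution I S \<and> no_revisit S})"

end

theory Submission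
  imports Defs "HOL-Library.Sublist"
begin

text \<open>
  Cut a sortie from \<open>i\<close> to \<open>k\<close> at its half-time: let \<open>xs\<close> be the nodes reached in the first half
  and \<open>ys\<close> the remaining ones. Flying \<open>xs\<close> and returning to \<open>i\<close> is feasible, since every payload
  is carried as long as before. Flying from \<open>k\<close> directly to the first node of \<open>ys\<close> takes, by the
  triangle inequality, no longer than the second half, whereas in the sortie that node is reached
  only after the first half; so flying from \<open>k\<close> through \<open>ys\<close> back to \<open>k\<close> is feasible as well.
  These two loops together take at most twice as long as the sortie, and no longer than the sortie
  if it serves a single node, because then only one of them is needed.

  A loop can be flown at any visit of its base while the truck waits. So the truck drives the cycle
  obtained from its route by shortcuts, and one drone flies all the loops one after the other. The
  sorties of each drone took at most the completion time \<open>C\<close>, hence the total waiting time is at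
  most \<open>2 m C\<close>, respectively \<open>m C\<close>.
\<close>

section \<open>Path lengths and the payload term of the energy\<close>

fun path_length :: "('a \<Rightarrow> 'a \<Rightarrow> real) \<Rightarrow> 'a list \<Rightarrow> real" where
  "path_length d (x # y # zs) = d x y + path_length d (y # zs)"
| "path_length d _ = 0"

text \<open>The payload term of the energy, for a flight that has already lasted \<open>a\<close> at the head of the
  list; the last node is the landing node and has no payload.\<close>

fun carry :: "('a \<Rightarrow> 'a \<Rightarrow> real) \<Rightarrow> ('a \<Rightarrow> real) \<Rightarrow> real \<Rightarrow> 'a list \<Rightarrow> real" where
  "carry d w a (x # y # z # zs) = w y * (a + d x y) + carry d w (a + d x y) (y # z # zs)"
| "carry d w a _ = 0"

lemma path_length_conv_sum:
  "path_length d p = (\<Sum>q<length p - 1. d (p ! q) (p ! Suc q))"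
  by (induction d p rule: path_length.induct) (simp_all add: sum.lessThan_Suc_shift del: sum.lessThan_Suc)

lemma carry_conv_sum:
  "carry d w a p =
     (\<Sum>k = 1..<length p - 1. w (p ! k) * (a + (\<Sum>q<k. d (p ! q) (p ! Suc q))))"
proof (induction d w a p rule: carry.induct)
  case (1 d w a x y z zs)
  let ?p = "x # y # z # zs"
  let ?f = "\<lambda>k. w (?p ! k) * (a + (\<Sum>q<k. d (?p ! q) (?p ! Suc q)))"
  have "(\<Sum>k = 1..<length ?p - 1. ?f k) = ?f 1 + (\<Sum>k = 1..<Suc (length zs). ?f (Suc k))"
    unfolding sum.shift_bounds_Suc_ivl [of ?f, symmetric]
    using sum.atLeast_Suc_lessThan [of 1 "Suc (Suc (length zs))" ?f]
    by (simp del: sum.op_ivl_Suc)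
  also have "(\<Sum>k = 1..<Suc (length zs). ?f (Suc k)) = carry d w (a + d x y) (y # z # zs)"
    unfolding 1 by (simp add: sum.lessThan_Suc_shift add.assoc del: sum.lessThan_Suc sum.op_ivl_Suc)
  finally show ?case by simp
qed simp_all

lemma sortie_duration_conv_path_length: "sortie_duration I p = path_length (drone_time I) p"
  by (simp add: sortie_duration_def path_length_conv_sum)

lemma sortie_energy_conv_carry:
  "sortie_energy I p =
     drone_weight I * path_length (drone_time I) p + carry (drone_time I) (payload I) 0 p"
  by (simp add: sortie_energy_def path_length_conv_sum carry_conv_sum)

lemma path_length_append:
  assumes "xs \<noteq> []" "ys \<noteq> []"
  shows "path_length d (xs @ ys) = path_length d xs + d (last xs) (hd ys) + path_length d ys"
  using assms
proof (induction d xs rule: path_length.induct)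
  case ("2_2" d v)
  then show ?case by (cases ys) auto
qed auto

lemma path_length_Cons: "ys \<noteq> [] \<Longrightarrow> path_length d (x # ys) = d x (hd ys) + path_length d ys"
  by (cases ys) auto

lemma path_length_nonneg:
  assumes "Metric_space M d"
  shows "0 \<le> path_length d p"
  using Metric_space.nonneg [OF assms] by (induction d p rule: path_length.induct) auto

lemma dist_le_path_length:
  assumes M: "Metric_space M d"
  shows "p \<noteq> [] \<Longrightarrow> set p \<subseteq> M \<Longrightarrow> d (hd p) (last p) \<le> path_length d p"
proof (induction p rule: induct_list012)
  case (3 x y zs)
  then have "d x (last (y # zs)) \<le> d x y + d y (last (y # zs))"
    by (intro Metric_space.triangle [OF M]) (auto dest: last_in_set split: if_splits)
  with 3 show ?case by fastforce
qed (use Metric_space.mdist_zero [OF M] in auto)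

text \<open>By the triangle inequality, skipping a node never lengthens a path. The fixed end points
  \<open>a\<close> and \<open>b\<close> give every skipped node a neighbour on both sides;
  \<open>a\<close> varies in the induction, since each node passed becomes the new start.\<close>

lemma path_length_subseq_le:
  assumes M: "Metric_space M d" and "subseq xs ys"
  shows "set ys \<subseteq> M \<Longrightarrow> a \<in> M \<Longrightarrow> b \<in> M \<Longrightarrow>
    path_length d (a # xs @ [b]) \<le> path_length d (a # ys @ [b])"
  using assms(2)
proof (induction arbitrary: a rule: list_emb.induct)
  case (list_emb_Nil ys)
  then show ?case
    using dist_le_path_length [OF M, of "a # ys @ [b]"] by simp
next
  case (list_emb_Cons xs ys y)
  have "set xs \<subseteq> M"
    using list_emb_Cons by (auto dest: list_emb_set)
  then have "d a (hd (xs @ [b])) \<le> d a y + d y (hd (xs @ [b]))"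
    using list_emb_Cons.prems by (intro Metric_space.triangle [OF M]) (cases xs; auto)+
  then show ?case
    using list_emb_Cons.IH [of y] list_emb_Cons.prems by (simp add: path_length_Cons)
next
  case (list_emb_Cons2 x y xs ys)
  then show ?case by simp
qed

text \<open>The cut removes the arc being travelled at time \<open>t\<close>. This arc counts for
  neither part, so both bounds can hold at once.\<close>

lemma path_length_split:
  assumes "\<And>x y. 0 \<le> d x y" "0 \<le> t" "t \<le> path_length d p" "2 \<le> length p"
  shows "\<exists>xs ys. p = xs @ ys \<and> xs \<noteq> [] \<and> ys \<noteq> [] \<and>
    path_length d xs \<le> t \<and> path_length d ys \<le> path_length d p - t"
  using assms(2-4)
proof (induction p arbitrary: t rule: induct_list012)
  case (3 x y zs)
  show ?case
  \<comment> \<open>Going on only if \<open>zs\<close> is nonempty keeps the last node in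
    \<open>ys\<close>, even when \<open>t\<close> is the whole length.\<close>
  proof (cases "d x y \<le> t \<and> zs \<noteq> []")
    case True
    have "\<exists>xs ys. y # zs = xs @ ys \<and> xs \<noteq> [] \<and> ys \<noteq> [] \<and>
        path_length d xs \<le> t - d x y \<and> path_length d ys \<le> path_length d (y # zs) - (t - d x y)"
      using True "3.prems" by (intro "3.IH"(2)) (auto simp: Suc_le_eq)
    then obtain xs ys where "y # zs = xs @ ys" "xs \<noteq> []" "ys \<noteq> []" "path_length d xs \<le> t - d x y"
        "path_length d ys \<le> path_length d (y # zs) - (t - d x y)"
      by blast
    note xy = this
    have "d x (hd xs) = d x y"
      using xy(1,2) by (cases xs) auto
    then have "path_length d (x # xs) \<le> t" "path_length d ys \<le> path_length d (x # y # zs) - t"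
      using xy by (auto simp: path_length_Cons)
    moreover have "x # y # zs = (x # xs) @ ys"
      using xy(1) by simp
    ultimately show ?thesis
      using xy(3) by blast
  next
    case False
    then have "path_length d (y # zs) \<le> path_length d (x # y # zs) - t"
      using "3.prems" by (cases zs) auto
    moreover have "x # y # zs = [x] @ y # zs" "path_length d [x] \<le> t"
      using "3.prems" by auto
    ultimately show ?thesis
      by blast
  qed
qed auto

text \<open>Both flights continue identically from \<open>hd ys\<close>, so whichever reaches that
  node earlier is ahead at all later nodes. The launch nodes \<open>x\<close> and \<open>y\<close>
  contribute no payload.\<close>

lemma carry_mono:
  assumes "a + d x (hd ys) \<le> b + d y (hd ys)" "\<forall>z\<in>set (butlast ys). 0 \<le> w z"
  shows "carry d w a (x # ys) \<le> carry d w b (y # ys)"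
  using assms
proof (induction ys arbitrary: a b x y)
  case (Cons z zs)
  show ?case
  proof (cases zs)
    case (Cons u us)
    then have "carry d w (a + d x z) (z # zs) \<le> carry d w (b + d y z) (z # zs)"
      using Cons.prems by (intro Cons.IH) auto
    moreover have "w z * (a + d x z) \<le> w z * (b + d y z)"
      using Cons Cons.prems by (intro mult_left_mono) auto
    ultimately show ?thesis
      using Cons by simp
  qed simp
qed simp

lemma carry_nonneg:
  assumes "0 \<le> a" "\<And>x y. 0 \<le> d x y" "\<forall>z\<in>set (butlast (tl p)). 0 \<le> w z"
  shows "0 \<le> carry d w a p"
  using assms by (induction d w a p rule: carry.induct) auto

text \<open>Repeating \<open>last xs\<close> counts nothing twice, because a launch node has no
  payload in \<open>carry\<close>. The node \<open>z\<close> is arbitrary: neither its payload nor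
  the arc leading to it enters the value.\<close>

lemma carry_append:
  assumes "xs \<noteq> []" "ys \<noteq> []"
  shows "carry d w a (xs @ ys) =
    carry d w a (xs @ [z]) + carry d w (a + path_length d xs) (last xs # ys)"
  using assms
proof (induction xs arbitrary: a rule: induct_list012)
  case (3 x y xs)
  then obtain u us where "xs @ ys = u # us"
    by (cases "xs @ ys") auto
  moreover obtain v vs where "xs @ [z] = v # vs"
    by (cases "xs @ [z]") auto
  ultimately show ?case
    using "3.IH"(2) [of "a + d x y"] "3.prems" by (simp add: add.assoc)
qed auto

section \<open>Replacing a sortie by loops at its end points\<close>

text \<open>The end points of a sortie are visited by the truck, so the loops need not serve them.\<close>

definition loops_for :: "'a tspd \<Rightarrow> 'a list \<Rightarrow> real \<Rightarrow> 'a list list \<Rightarrow> bool" where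
  "loops_for I p T L \<longleftrightarrow>
     (\<forall>l \<in> set L. feasible_sortie I l \<and> is_loop l \<and> hd l \<in> {hd p, last p}) \<and>
     served p \<subseteq> {hd p, last p} \<union> (\<Union>l \<in> set L. served l) \<and>
     sum_list (map (sortie_duration I) L) \<le> T"

lemma served_append_last: "xs \<noteq> [] \<Longrightarrow> served (xs @ [z]) = set (tl xs)"
  by (cases xs) (auto simp: served_def)

lemma served_append:
  "xs \<noteq> [] \<Longrightarrow> ys \<noteq> [] \<Longrightarrow> served (xs @ ys) = set (tl xs) \<union> set (butlast ys)"
  by (cases xs) (auto simp: served_def butlast_append)

lemma length_ge3_if_returning:
  "distinct_adj xs \<Longrightarrow> hd xs = last xs \<Longrightarrow> 2 \<le> length xs \<Longrightarrow> 3 \<le> length xs"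
  by (cases xs; cases "tl xs"; cases "tl (tl xs)") auto

lemma feasible_sortie_nodes:
  assumes "tspd_instance I" "feasible_sortie I p"
  shows "set p \<subseteq> nodes I"
proof
  fix x assume "x \<in> set p"
  from assms(2) obtain a ys b where p: "p = a # ys @ [b]"
    unfolding feasible_sortie_def sortie_def
    by (cases p; cases "tl p" rule: rev_cases) auto
  then show "x \<in> nodes I"
    using assms \<open>x \<in> set p\<close>
    by (auto simp: feasible_sortie_def sortie_def tspd_instance_def served_def)
qed

text \<open>Consecutive nodes of a sortie differ, which forces three cases: \<open>xs\<close> is a
  single node and no loop is flown, \<open>xs\<close> already ends at its base and is the loop
  itself, or the base is appended. The way back is no longer than \<open>xs\<close>, and
  \<open>short\<close> then bounds the weight term of the energy.\<close>

lemma forward_loop: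
  assumes I: "tspd_instance I" and p: "feasible_sortie I (xs @ ys)" "xs \<noteq> []" "ys \<noteq> []"
    and short: "2 * path_length (drone_time I) xs \<le> path_length (drone_time I) (xs @ ys)"
  shows "\<exists>L. (\<forall>l \<in> set L. feasible_sortie I l \<and> is_loop l \<and> hd l = hd xs) \<and>
    set (tl xs) \<subseteq> insert (hd xs) (\<Union>l \<in> set L. served l) \<and>
    sum_list (map (sortie_duration I) L) \<le> 2 * path_length (drone_time I) xs"
proof -
  define d where "d = drone_time I"
  have M: "Metric_space (nodes I) d"
    using I by (simp add: tspd_instance_def d_def)
  have nn: "\<And>x y. 0 \<le> d x y"
    using Metric_space.nonneg [OF M] .
  have w: "0 < drone_weight I" and pay: "\<forall>z\<in>drone_nodes I. 0 \<le> payload I z"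
    using I by (auto simp: tspd_instance_def)
  have s: "set (tl xs) \<subseteq> drone_nodes I" "hd xs \<in> truck_nodes I" "set (butlast ys) \<subseteq> drone_nodes I"
      and adj: "distinct_adj xs"
    using p by (auto simp: feasible_sortie_def sortie_def served_append)
  have nodes: "set xs \<subseteq> nodes I"
    using feasible_sortie_nodes [OF I p(1)] by simp
  \<comment> \<open>Landing right after \<open>us\<close> leaves the terms of \<open>us\<close>
    unchanged and drops only the nonnegative terms of \<open>vs\<close>.\<close>
  have carry: "carry d (payload I) 0 (us @ [z]) \<le> carry d (payload I) 0 (us @ vs)"
    if "us \<noteq> []" "vs \<noteq> []" "set (butlast vs) \<subseteq> drone_nodes I" for us vs z
    using that carry_nonneg [of "path_length d us" d "last us # vs" "payload I"] nn pay
      path_length_nonneg [OF M, of us]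
    by (subst (2) carry_append [where z = z]) auto
  have E: "drone_weight I * path_length d (xs @ ys) + carry d (payload I) 0 (xs @ ys) \<le> battery I"
    using p by (simp add: feasible_sortie_def sortie_energy_conv_carry d_def)
  consider "length xs = 1" | "2 \<le> length xs" "hd xs = last xs" | "2 \<le> length xs" "hd xs \<noteq> last xs"
    using p(2) by (cases xs; cases "tl xs") auto
  then show ?thesis
  proof cases
    case 1
    then show ?thesis
      using path_length_nonneg [OF M, of xs]
      by (intro exI [of _ "[]"]) (auto simp: length_Suc_conv d_def)
  next
    case 2
    have len: "3 \<le> length xs"
      using length_ge3_if_returning adj 2 by auto
    obtain us where us: "xs = us @ [last xs]" "us \<noteq> []"
      using 2 p(2) by (cases xs rule: rev_cases) (auto, fastforce)
    \<comment> \<open>The last node of \<open>xs\<close> turns from a customer into the landing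
      node, so the sortie is cut just before it, with \<open>[last xs] @ ys\<close> as the part to
      be dropped.\<close>
    have "set (butlast ([last xs] @ ys)) \<subseteq> drone_nodes I"
    proof -
      have "last xs \<in> set (tl xs)"
        using us(2) by (subst us(1)) (cases us; simp)
      then show ?thesis using s p(3) by auto
    qed
    from carry [OF us(2) _ this, of "last xs"]
    have "carry d (payload I) 0 xs \<le> carry d (payload I) 0 (xs @ ys)"
      by (metis append.assoc append_Nil append_is_Nil_conv not_Cons_self2 us(1))
    moreover have "path_length d xs \<le> path_length d (xs @ ys)"
      using short path_length_nonneg [OF M, of xs] by (simp add: d_def)
    then have "drone_weight I * path_length d xs \<le> drone_weight I * path_length d (xs @ ys)"
      using w by simp
    ultimately have "sortie_energy I xs \<le> battery I"
      using E by (simp add: sortie_energy_conv_carry d_def)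
    moreover have sv: "served xs \<subseteq> set (tl xs)" "set (tl xs) \<subseteq> insert (last xs) (served xs)"
      using us(2) by (subst (1 2) us(1), cases us, force, force simp: served_def butlast_append)
        (subst (1 3) us(1), cases us, force, force simp: served_def butlast_append)
    ultimately have "feasible_sortie I xs"
      using s 2 len adj by (auto simp: feasible_sortie_def sortie_def)
    then show ?thesis
      using 2 sv path_length_nonneg [OF M, of xs]
      by (intro exI [of _ "[xs]"])
        (auto simp: is_loop_def sortie_duration_conv_path_length d_def)
  next
    case 3
    let ?l = "xs @ [hd xs]"
    have "d (last xs) (hd xs) \<le> path_length d xs"
      using dist_le_path_length [OF M p(2) nodes] Metric_space.commute [OF M] by simp
    then have len: "path_length d ?l \<le> 2 * path_length d xs"
      using p(2) by (simp add: path_length_append)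
    then have "path_length d ?l \<le> path_length d (xs @ ys)"
      using short by (simp add: d_def)
    then have "drone_weight I * path_length d ?l \<le> drone_weight I * path_length d (xs @ ys)"
      using w by simp
    then have "sortie_energy I ?l \<le> battery I"
      using E carry [OF p(2,3) s(3), of "hd xs"] by (simp add: sortie_energy_conv_carry d_def)
    then have "feasible_sortie I ?l"
      using s 3 adj p(2)
      by (auto simp: feasible_sortie_def sortie_def served_append_last distinct_adj_append_iff)
    then show ?thesis
      using len p(2)
      by (intro exI [of _ "[?l]"])
        (auto simp: is_loop_def sortie_duration_conv_path_length d_def served_append_last)
  qed
qed

text \<open>The part \<open>ys\<close> is flown in its original direction, since reversing it could
  lengthen the time for which a payload is carried. The three cases are those of
  \<open>forward_loop\<close>, with the base put in front instead of behind.\<close>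

lemma backward_loop:
  assumes I: "tspd_instance I" and p: "feasible_sortie I (xs @ ys)" "xs \<noteq> []" "ys \<noteq> []"
    and short: "2 * path_length (drone_time I) ys \<le> path_length (drone_time I) (xs @ ys)"
  shows "\<exists>L. (\<forall>l \<in> set L. feasible_sortie I l \<and> is_loop l \<and> hd l = last ys) \<and>
    set (butlast ys) \<subseteq> insert (last ys) (\<Union>l \<in> set L. served l) \<and>
    sum_list (map (sortie_duration I) L) \<le> 2 * path_length (drone_time I) ys"
proof -
  define d where "d = drone_time I"
  have M: "Metric_space (nodes I) d"
    using I by (simp add: tspd_instance_def d_def)
  have nn: "\<And>x y. 0 \<le> d x y"
    using Metric_space.nonneg [OF M] .
  have w: "0 < drone_weight I" and pay: "\<forall>z\<in>drone_nodes I. 0 \<le> payload I z"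
    using I by (auto simp: tspd_instance_def)
  have s: "set (butlast ys) \<subseteq> drone_nodes I" "last ys \<in> truck_nodes I" "set (tl xs) \<subseteq> drone_nodes I"
      and adj: "distinct_adj ys"
    using p by (auto simp: feasible_sortie_def sortie_def served_append)
  have nodes: "set ys \<subseteq> nodes I"
    using feasible_sortie_nodes [OF I p(1)] by simp
  have return: "d (last ys) (hd ys) \<le> path_length d ys"
    using dist_le_path_length [OF M p(3) nodes] Metric_space.commute [OF M] by simp
  \<comment> \<open>As \<open>ys\<close> takes at most half of the sortie, the rest takes at least
    as long as \<open>ys\<close>, and this rest is exactly the time at which the sortie reaches
    \<open>hd ys\<close>.\<close>
  have far: "path_length d ys \<le> path_length d xs + d (last xs) (hd ys)"
    using short p(2,3) by (simp add: path_length_append d_def)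
  have "0 \<le> carry d (payload I) 0 (xs @ [last ys])"
    using s(3) nn pay p(2) by (intro carry_nonneg) (auto simp: butlast_append)
  then have suffix: "carry d (payload I) (path_length d xs) (last xs # ys)
      \<le> carry d (payload I) 0 (xs @ ys)"
    using p(2,3) by (simp add: carry_append [of xs ys _ _ _ "last ys"])
  have E: "drone_weight I * path_length d (xs @ ys) + carry d (payload I) 0 (xs @ ys) \<le> battery I"
    using p by (simp add: feasible_sortie_def sortie_energy_conv_carry d_def)
  consider "length ys = 1" | "2 \<le> length ys" "hd ys = last ys" | "2 \<le> length ys" "hd ys \<noteq> last ys"
    using p(3) by (cases ys; cases "tl ys") auto
  then show ?thesis
  proof cases
    case 1
    then show ?thesis
      using path_length_nonneg [OF M, of ys]
      by (intro exI [of _ "[]"]) (auto simp: length_Suc_conv d_def)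
  next
    case 2
    have len: "3 \<le> length ys"
      using length_ge3_if_returning adj 2 by auto
    then obtain y z zs where ys: "ys = y # z # zs"
      by (cases ys; cases "tl ys") auto
    \<comment> \<open>Starting at \<open>hd ys\<close> with elapsed time 0 makes all later carrying
      times smaller; the next inequality drops the payload of \<open>hd ys\<close>, which is now the
      launch node.\<close>
    have "carry d (payload I) 0 ys \<le> carry d (payload I) (path_length d xs + d (last xs) y) ys"
      unfolding ys using s pay nn path_length_nonneg [OF M, of xs]
      by (intro carry_mono) (auto simp: ys)
    also have "\<dots> \<le> carry d (payload I) (path_length d xs) (last xs # ys)"
      using s pay nn path_length_nonneg [OF M, of xs] by (simp add: ys)
    also note suffix
    finally have "carry d (payload I) 0 ys \<le> carry d (payload I) 0 (xs @ ys)" .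
    moreover have "path_length d ys \<le> path_length d (xs @ ys)"
      using short path_length_nonneg [OF M, of ys] by (simp add: d_def)
    then have "drone_weight I * path_length d ys \<le> drone_weight I * path_length d (xs @ ys)"
      using w by simp
    ultimately have "sortie_energy I ys \<le> battery I"
      using E by (simp add: sortie_energy_conv_carry d_def)
    moreover have sv: "served ys \<subseteq> set (butlast ys)" "set (butlast ys) \<subseteq> insert (hd ys) (served ys)"
      by (auto simp: served_def ys)
    ultimately have "feasible_sortie I ys"
      using s 2 len adj by (auto simp: feasible_sortie_def sortie_def)
    then show ?thesis
      using 2 sv path_length_nonneg [OF M, of ys]
      by (intro exI [of _ "[ys]"])
        (auto simp: is_loop_def sortie_duration_conv_path_length d_def)
  next
    case 3
    let ?l = "last ys # ys"
    have len: "path_length d ?l \<le> 2 * path_length d ys"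
      using p(3) return by (simp add: path_length_Cons)
    then have "path_length d ?l \<le> path_length d (xs @ ys)"
      using short by (simp add: d_def)
    then have "drone_weight I * path_length d ?l \<le> drone_weight I * path_length d (xs @ ys)"
      using w by simp
    moreover have "carry d (payload I) 0 ?l \<le> carry d (payload I) (path_length d xs) (last xs # ys)"
      using return far s pay by (intro carry_mono) auto
    ultimately have "sortie_energy I ?l \<le> battery I"
      using E suffix by (simp add: sortie_energy_conv_carry d_def)
    then have "feasible_sortie I ?l"
      using s 3 adj p(3)
      by (auto simp: feasible_sortie_def sortie_def served_def distinct_adj_Cons)
    then show ?thesis
      using len p(3)
      by (intro exI [of _ "[?l]"])
        (auto simp: is_loop_def sortie_duration_conv_path_length d_def served_def)
  qed
qed

text \<open>The bound keeps the two parts apart, so that it can be improved when one of them is a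
  single node and has length 0.\<close>

lemma loops_for_split:
  assumes I: "tspd_instance I" and p: "feasible_sortie I p"
  obtains xs ys L where "p = xs @ ys" "xs \<noteq> []" "ys \<noteq> []"
    "2 * path_length (drone_time I) xs \<le> sortie_duration I p"
    "2 * path_length (drone_time I) ys \<le> sortie_duration I p"
    "loops_for I p (2 * path_length (drone_time I) xs + 2 * path_length (drone_time I) ys) L"
proof -
  let ?d = "drone_time I"
  have M: "Metric_space (nodes I) ?d"
    using I by (simp add: tspd_instance_def)
  have "2 \<le> length p"
    using p by (simp add: feasible_sortie_def sortie_def)
  then obtain xs ys where xy: "p = xs @ ys" "xs \<noteq> []" "ys \<noteq> []"
      "path_length ?d xs \<le> path_length ?d p / 2"
      "path_length ?d ys \<le> path_length ?d p - path_length ?d p / 2"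
    using path_length_split [of ?d "path_length ?d p / 2" p, OF Metric_space.nonneg [OF M]]
      path_length_nonneg [OF M, of p] by auto
  obtain L1 where L1: "\<forall>l \<in> set L1. feasible_sortie I l \<and> is_loop l \<and> hd l = hd xs"
      "set (tl xs) \<subseteq> insert (hd xs) (\<Union>l \<in> set L1. served l)"
      "sum_list (map (sortie_duration I) L1) \<le> 2 * path_length ?d xs"
    using forward_loop [of I xs ys] I p xy by auto
  obtain L2 where L2: "\<forall>l \<in> set L2. feasible_sortie I l \<and> is_loop l \<and> hd l = last ys"
      "set (butlast ys) \<subseteq> insert (last ys) (\<Union>l \<in> set L2. served l)"
      "sum_list (map (sortie_duration I) L2) \<le> 2 * path_length ?d ys"
    using backward_loop [of I xs ys] I p xy by auto
  have "loops_for I p (2 * path_length ?d xs + 2 * path_length ?d ys) (L1 @ L2)"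
    using L1 L2 xy(2,3) unfolding loops_for_def xy(1) by (auto simp: served_append)
  with xy show ?thesis
    by (intro that) (auto simp: sortie_duration_conv_path_length)
qed

lemma loops_for_mono: "loops_for I p S L \<Longrightarrow> S \<le> T \<Longrightarrow> loops_for I p T L"
  by (auto simp: loops_for_def)

lemma ex_loops_for_double:
  assumes "tspd_instance I" "feasible_sortie I p"
  shows "\<exists>L. loops_for I p (2 * sortie_duration I p) L"
  using loops_for_split [OF assms] loops_for_mono by (metis add_mono mult_2)

text \<open>A loop replaces itself. Otherwise the sortie has three nodes, so one part of the cut has
  length 0, and twice the other part is at most the duration.\<close>

lemma ex_loops_for_loop_or_single:
  assumes "tspd_instance I" "feasible_sortie I p" "is_loop p \<or> card (served p) = 1"
  shows "\<exists>L. loops_for I p (sortie_duration I p) L"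
proof (cases "is_loop p")
  case True
  then show ?thesis
    using assms by (intro exI [of _ "[p]"]) (auto simp: loops_for_def)
next
  case False
  with assms have "card (served p) = 1" by simp
  then obtain c where c: "served p = {c}"
    using card_1_singletonE by blast
  have p: "3 \<le> length p" "distinct_adj p"
    using assms by (auto simp: feasible_sortie_def sortie_def)
  have "length p = 3"
  \<comment> \<open>A longer sortie could serve a single node only by repeating it, but its second
    and third nodes are both served and differ.\<close>
  proof (rule ccontr)
    assume "length p \<noteq> 3"
    with p(1) have "Suc (Suc (Suc (Suc 0))) \<le> length p"
      by simp
    then obtain x y z u us where "p = x # y # z # u # us"
      by (auto simp: Suc_le_length_iff)
    with c p(2) show False
      by (auto simp: served_def split: if_splits)
  qed
  obtain xs ys L where L: "p = xs @ ys" "xs \<noteq> []" "ys \<noteq> []"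
    "2 * path_length (drone_time I) xs \<le> sortie_duration I p"
    "2 * path_length (drone_time I) ys \<le> sortie_duration I p"
    "loops_for I p (2 * path_length (drone_time I) xs + 2 * path_length (drone_time I) ys) L"
    using loops_for_split [OF assms(1,2)] .
  have "length xs = 1 \<or> length ys = 1"
    using \<open>length p = 3\<close> L(1-3) by (cases xs; cases ys; cases "tl xs") auto
  then have "path_length (drone_time I) xs = 0 \<or> path_length (drone_time I) ys = 0"
    by (auto simp: length_Suc_conv)
  with L(4-6) show ?thesis
    by (auto intro!: exI [of _ L] elim!: loops_for_mono)
qed

section \<open>Shortcutting the truck route to a cycle\<close>

lemma subseq_remdups: "subseq (remdups xs) xs"
  by (induction xs) auto

lemma distinct_adj_if_distinct: "distinct xs \<Longrightarrow> distinct_adj xs"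
  by (induction xs rule: induct_list012) auto

lemma ex_shortcut:
  assumes I: "tspd_instance I" and vs: "truck_route I vs"
  shows "\<exists>us. truck_route I us \<and> set us = set vs \<and> distinct (butlast us) \<and>
    path_length (truck_time I) us \<le> path_length (truck_time I) vs"
proof -
  have M: "Metric_space (nodes I) (truck_time I)" and sub: "truck_nodes I \<subseteq> nodes I"
    using I by (simp_all add: tspd_instance_def)
  show ?thesis
  \<comment> \<open>If the truck never leaves the depot, closing the empty list of remaining nodes
    would give two equal consecutive nodes; the route \<open>[depot I]\<close> is taken
    instead.\<close>
  proof (cases "set vs = {depot I}")
    case True
    then show ?thesis
      using vs path_length_nonneg [OF M, of vs]
      by (intro exI [of _ "[depot I]"]) (auto simp: truck_route_def)
  next
    case False
    define z where "z = depot I"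
    obtain ms where ms: "vs = z # ms @ [z]"
    proof (cases vs)
      case (Cons x xs)
      with that show ?thesis
        using vs False by (cases xs rule: rev_cases) (auto simp: truck_route_def z_def)
    qed (use vs in \<open>simp add: truck_route_def\<close>)
    define ks where "ks = remdups (filter (\<lambda>x. x \<noteq> z) ms)"
    have "subseq ks ms"
      unfolding ks_def by (meson subseq_filter_left subseq_order.order_trans subseq_remdups)
    then have "path_length (truck_time I) (z # ks @ [z]) \<le> path_length (truck_time I) vs"
      unfolding ms using vs sub ms
      by (intro path_length_subseq_le [OF M]) (auto simp: truck_route_def)
    moreover have "set ks = set ms - {z}" "distinct ks" "ks \<noteq> []"
      using False by (auto simp: ks_def ms z_def filter_empty_conv)
    moreover from this have "distinct_adj (z # ks @ [z])"
      using last_in_set [of ks] hd_in_set [of ks]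
      by (auto simp: distinct_adj_Cons distinct_adj_append_iff distinct_adj_if_distinct)
    ultimately show ?thesis
      using vs unfolding ms
      by (intro exI [of _ "z # ks @ [z]"]) (auto simp: truck_route_def butlast_append)
  qed
qed

section \<open>Schedules and bounds on completion times\<close>

definition travel_time :: "'a tspd \<Rightarrow> 'a list \<Rightarrow> nat \<Rightarrow> real" where
  "travel_time I vs t = (\<Sum>q<t. truck_time I (vs ! q) (vs ! Suc q))"

lemma travel_time_simps:
  "travel_time I vs 0 = 0"
  "travel_time I vs (Suc t) = travel_time I vs t + truck_time I (vs ! t) (vs ! Suc t)"
  by (simp_all add: travel_time_def)

lemma travel_time_mono:
  assumes "tspd_instance I" "s \<le> t"
  shows "travel_time I vs s \<le> travel_time I vs t"
proof -
  have "Metric_space (nodes I) (truck_time I)"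
    using assms by (simp add: tspd_instance_def)
  then show ?thesis
    unfolding travel_time_def using assms(2) Metric_space.nonneg
    by (intro sum_mono2) fastforce+
qed

lemma sortie_duration_nonneg: "tspd_instance I \<Longrightarrow> 0 \<le> sortie_duration I p"
  by (auto simp: sortie_duration_conv_path_length tspd_instance_def intro: path_length_nonneg)

text \<open>This makes the infimum in \<open>completion_time\<close> one over a nonempty set. The
  truck waits at every visit for \<open>K\<close>, the total duration of all flights.\<close>

lemma ex_schedule:
  assumes I: "tspd_instance I" and S: "feasible_solution I S"
  shows "\<exists>arr dep lau ret. schedule I S arr dep lau ret"
proof -
  define dur where "dur d j = sortie_duration I (tour (flights S ! d ! j))" for d j
  define K where "K = (\<Sum>d<length (flights S). \<Sum>j<length (flights S ! d). dur d j)"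
  have dur: "0 \<le> dur d j" for d j
    using sortie_duration_nonneg [OF I] by (simp add: dur_def)
  have K: "(\<Sum>i<j. dur d i) \<le> K" if "d < length (flights S)" "j \<le> length (flights S ! d)" for d j
  proof -
    have "(\<Sum>i<j. dur d i) \<le> (\<Sum>i<length (flights S ! d). dur d i)"
      using that dur by (intro sum_mono2) auto
    also have "\<dots> \<le> K"
      unfolding K_def using that dur by (intro member_le_sum sum_nonneg) auto
    finally show ?thesis .
  qed
  have "0 \<le> K"
    unfolding K_def by (intro sum_nonneg dur)
  define arr where "arr t = travel_time I (route S) t + real t * K" for t
  have arr: "arr s \<le> arr t" if "s \<le> t" for s t
    using travel_time_mono [OF I that] that \<open>0 \<le> K\<close> by (auto simp: arr_def intro!: add_mono mult_right_mono)
  \<comment> \<open>Within its visit, each launch is delayed by the durations of the earlier flights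
    of the same drone. These delays grow with \<open>j\<close> and never exceed \<open>K\<close>,
    which gives both the order of the flights and the departure bounds.\<close>
  define lau where "lau d j = arr (launch_visit (flights S ! d ! j)) + (\<Sum>i<j. dur d i)" for d j
  define ret where "ret d j = arr (retrieve_visit (flights S ! d ! j)) + (\<Sum>i<Suc j. dur d i)" for d j
  have "schedule I S arr (\<lambda>t. arr t + K) lau ret"
    unfolding schedule_def Let_def
  proof (intro conjI allI impI)
    fix d j assume dj: "d < length (flights S)" "j < length (flights S ! d)"
    have "feasible_flight I (route S) (flights S ! d ! j)"
      using S dj unfolding feasible_solution_def by (meson nth_mem)
    then have "arr (launch_visit (flights S ! d ! j)) \<le> arr (retrieve_visit (flights S ! d ! j))"
      by (intro arr) (simp add: feasible_flight_def)
    then show "lau d j + sortie_duration I (tour (flights S ! d ! j)) \<le> ret d j"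
      by (simp add: lau_def ret_def dur_def)
    show "arr (launch_visit (flights S ! d ! j)) \<le> lau d j"
      "arr (retrieve_visit (flights S ! d ! j)) \<le> ret d j"
      unfolding lau_def ret_def using dur by (simp_all add: sum_nonneg del: sum.lessThan_Suc)
    show "lau d j \<le> arr (launch_visit (flights S ! d ! j)) + K"
      "ret d j \<le> arr (retrieve_visit (flights S ! d ! j)) + K"
      unfolding lau_def ret_def using K [of d j] K [of d "Suc j"] dj by simp_all
  next
    fix d j assume dj: "d < length (flights S)" "Suc j < length (flights S ! d)"
    then have "retrieve_visit (flights S ! d ! j) \<le> launch_visit (flights S ! d ! Suc j)"
      using S by (auto simp: feasible_solution_def)
    then show "ret d j \<le> lau d (Suc j)"
      using arr by (simp add: lau_def ret_def)
  qed (simp_all add: arr_def travel_time_simps algebra_simps \<open>0 \<le> K\<close>)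
  then show ?thesis by blast
qed

lemma travel_time_le_schedule:
  assumes "schedule I S arr dep lau ret" "t < length (route S)"
  shows "travel_time I (route S) t \<le> arr t"
  using assms(2)
proof (induction t)
  case (Suc t)
  then have "arr t \<le> dep t" "arr (Suc t) = dep t + truck_time I (route S ! t) (route S ! Suc t)"
    using assms(1) by (simp_all add: schedule_def)
  then show ?case
    using Suc by (simp add: travel_time_simps)
qed (use assms(1) in \<open>simp add: schedule_def travel_time_simps\<close>)

lemma schedule_dep_mono:
  assumes I: "tspd_instance I" and "schedule I S arr dep lau ret" "s \<le> t" "t < length (route S)"
  shows "dep s \<le> dep t"
  using assms(3,4)
proof (induction t rule: dec_induct)
  case (step t)
  have "arr (Suc t) \<le> dep (Suc t)"
    "arr (Suc t) = dep t + truck_time I (route S ! t) (route S ! Suc t)"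
    using assms(2) step.prems unfolding schedule_def by blast+
  moreover have "0 \<le> truck_time I (route S ! t) (route S ! Suc t)"
    using I Metric_space.nonneg by (fastforce simp: tspd_instance_def)
  ultimately show ?case
    using step by simp
qed simp

lemma path_length_le_schedule:
  assumes I: "tspd_instance I" and S: "feasible_solution I S" and sch: "schedule I S arr dep lau ret"
  shows "path_length (truck_time I) (route S) \<le> dep (length (route S) - 1)"
proof -
  have "length (route S) - 1 < length (route S)"
    using S by (simp add: feasible_solution_def truck_route_def)
  then have "travel_time I (route S) (length (route S) - 1) \<le> arr (length (route S) - 1)"
    "arr (length (route S) - 1) \<le> dep (length (route S) - 1)"
    using travel_time_le_schedule [OF sch] sch by (auto simp: schedule_def)
  then show ?thesis
    by (simp add: travel_time_def path_length_conv_sum)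
qed

text \<open>The flights of one drone occupy successive time intervals, none starting before time 0
  and none ending after the last departure.\<close>

lemma drone_time_le_schedule:
  assumes I: "tspd_instance I" and S: "feasible_solution I S" and sch: "schedule I S arr dep lau ret"
    and F: "F \<in> set (flights S)"
  shows "sum_list (map (\<lambda>f. sortie_duration I (tour f)) F) \<le> dep (length (route S) - 1)"
proof -
  let ?dur = "\<lambda>j. sortie_duration I (tour (F ! j))"
  obtain d where d: "d < length (flights S)" "F = flights S ! d"
    using F by (metis in_set_conv_nth)
  have fl: "arr (launch_visit (F ! j)) \<le> lau d j" "lau d j + ?dur j \<le> ret d j"
      "ret d j \<le> dep (retrieve_visit (F ! j))" "launch_visit (F ! j) < length (route S)"
      "retrieve_visit (F ! j) < length (route S)"
    if "j < length F" for j
  proof -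
    have "feasible_flight I (route S) (F ! j)"
      using S F that by (auto simp: feasible_solution_def)
    then show "launch_visit (F ! j) < length (route S)" "retrieve_visit (F ! j) < length (route S)"
      by (auto simp: feasible_flight_def)
  qed (use sch d that in \<open>auto simp: schedule_def Let_def\<close>)
  have sum: "(\<Sum>i<Suc j. ?dur i) \<le> ret d j" if "j < length F" for j
    using that
  proof (induction j)
    case 0
    then have "0 \<le> arr (launch_visit (F ! 0))"
      using travel_time_le_schedule [OF sch fl(4) [of 0]]
        travel_time_mono [OF I, of 0 "launch_visit (F ! 0)" "route S"]
      by (simp add: travel_time_simps)
    then show ?case
      using fl(1,2) [of 0] 0 by simp
  next
    case (Suc j)
    have "ret d j \<le> lau d (Suc j)"
      using sch Suc d by (simp add: schedule_def)
    then show ?case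
      using Suc fl(2) [of "Suc j"] by simp
  qed
  show ?thesis
  proof (cases "length F")
    case 0
    have "0 \<le> path_length (truck_time I) (route S)"
      using I by (auto simp: tspd_instance_def intro: path_length_nonneg)
    then show ?thesis
      using 0 path_length_le_schedule [OF I S sch] by simp
  next
    case (Suc n)
    then have "sum_list (map (\<lambda>f. sortie_duration I (tour f)) F) \<le> ret d n"
      using sum [of n] by (simp add: sum_list_sum_nth atLeast0LessThan)
    also have "\<dots> \<le> dep (retrieve_visit (F ! n))"
      using fl(3) Suc by simp
    also have "\<dots> \<le> dep (length (route S) - 1)"
      using fl(5) [of n] Suc by (intro schedule_dep_mono [OF I sch]) auto
    finally show ?thesis .
  qed
qed

lemma schedule_end_nonneg:
  assumes I: "tspd_instance I" and "feasible_solution I S" "schedule I S arr dep lau ret"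
  shows "0 \<le> dep (length (route S) - 1)"
proof -
  have "0 \<le> path_length (truck_time I) (route S)"
    using I by (auto simp: tspd_instance_def intro: path_length_nonneg)
  then show ?thesis
    using path_length_le_schedule [OF assms] by simp
qed

lemma completion_time_le:
  assumes "tspd_instance I" "feasible_solution I S" "schedule I S arr dep lau ret"
  shows "completion_time I S \<le> dep (length (route S) - 1)"
  unfolding completion_time_def
  by (rule cInf_lower) (use assms schedule_end_nonneg in \<open>auto intro!: bdd_belowI [of _ 0]\<close>)

lemma completion_time_ge:
  assumes "tspd_instance I" "feasible_solution I S"
    and "\<And>arr dep lau ret. schedule I S arr dep lau ret \<Longrightarrow> c \<le> dep (length (route S) - 1)"
  shows "c \<le> completion_time I S"
  unfolding completion_time_def
  by (rule cInf_greatest) (use assms(3) ex_schedule [OF assms(1,2)] in auto)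

section \<open>One drone flying all loops along a given route\<close>

lemma sum_list_map_sort_key:
  fixes g :: "'a \<Rightarrow> 'b :: comm_monoid_add"
  shows "sum_list (map g (sort_key k xs)) = sum_list (map g xs)"
proof -
  have "sum_list (map g (insort_key k x xs)) = g x + sum_list (map g xs)" for x xs
    by (induction xs) (auto simp: add.left_commute)
  then show ?thesis
    by (induction xs) auto
qed

lemma ex_loop_solution:
  assumes I: "tspd_instance I" and vs: "truck_route I vs"
    and L: "\<And>l. l \<in> set L \<Longrightarrow> feasible_sortie I l \<and> is_loop l \<and> hd l \<in> set vs"
    and cover: "nodes I \<subseteq> set vs \<union> (\<Union>l \<in> set L. served l)"
  shows "\<exists>S. feasible_solution I S \<and> route S = vs \<and>
    completion_time I S \<le> path_length (truck_time I) vs + sum_list (map (sortie_duration I) L)"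
proof -
  define pos where "pos x = (SOME t. t < length vs \<and> vs ! t = x)" for x
  have pos: "pos x < length vs \<and> vs ! pos x = x" if "x \<in> set vs" for x
    unfolding pos_def
    by (rule someI_ex [of "\<lambda>t. t < length vs \<and> vs ! t = x"]) (use that in \<open>simp add: in_set_conv_nth\<close>)
  define fl where
    "fl l = \<lparr>tour = l, launch_visit = pos (hd l), retrieve_visit = pos (hd l)\<rparr>" for l
  \<comment> \<open>Each loop begins and ends at the same visit, so sorting by visits suffices for a
    single drone to fly them in this order.\<close>
  define F where "F = sort_key launch_visit (map fl L)"
  define S where "S = \<lparr>route = vs, flights = F # replicate (drones I - 1) []\<rparr>"
  have m: "1 \<le> drones I"
    using I by (simp add: tspd_instance_def)
  have F: "retrieve_visit f = launch_visit f \<and> feasible_flight I vs f" if "f \<in> set F" for f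
  proof -
    obtain l where l: "l \<in> set L" "f = fl l"
      using \<open>f \<in> set F\<close> by (auto simp: F_def)
    show ?thesis
      using L [OF l(1)] pos [of "hd l"] by (auto simp: l(2) fl_def feasible_flight_def is_loop_def)
  qed
  have sorted: "launch_visit (F ! i) \<le> launch_visit (F ! j)" if "i \<le> j" "j < length F" for i j
    using sorted_nth_mono [of "map launch_visit F" i j] that by (simp add: F_def)
  have S: "feasible_solution I S"
    unfolding feasible_solution_def
  proof (intro conjI ballI allI impI)
    fix G f assume "G \<in> set (flights S)" "f \<in> set G"
    then show "feasible_flight I (route S) f"
      using F by (auto simp: S_def)
  next
    fix G j assume "G \<in> set (flights S)" "Suc j < length G"
    then have "G = F" "Suc j < length F"
      by (auto simp: S_def)
    then show "retrieve_visit (G ! j) \<le> launch_visit (G ! Suc j)"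
      using F [of "F ! j"] sorted [of j "Suc j"] by simp
  next
    have "(\<Union>f\<in>set F. served (tour f)) = (\<Union>l\<in>set L. served l)"
      by (simp add: F_def fl_def)
    then show "nodes I \<subseteq> set (route S) \<union> (\<Union>F\<in>set (flights S). \<Union>f\<in>set F. served (tour f))"
      using cover by (auto simp: S_def)
  qed (use vs m in \<open>auto simp: S_def\<close>)
  define dur where "dur j = sortie_duration I (tour (F ! j))" for j
  have dur: "0 \<le> dur j" for j
    using sortie_duration_nonneg [OF I] by (simp add: dur_def)
  \<comment> \<open>\<open>W t\<close> is the waiting time spent before visit \<open>t\<close>. The
    truck leaves a visit after exactly the loops assigned to it, hence \<open>W (Suc t)\<close> in
    \<open>dep\<close>; \<open>W_le\<close> and \<open>W_ge\<close> place each flight between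
    arrival and departure.\<close>
  define W where "W t = sum dur {j. j < length F \<and> launch_visit (F ! j) < t}" for t
  have W_le: "W (launch_visit (F ! j)) \<le> sum dur {..<j}" if "j < length F" for j
  proof -
    have "i < j" if "launch_visit (F ! i) < launch_visit (F ! j)" "i < length F" for i
      using sorted [of j i] that by (meson leD not_le_imp_less)
    then show ?thesis
      unfolding W_def using dur by (intro sum_mono2) auto
  qed
  have W_ge: "sum dur {..<Suc j} \<le> W (Suc (launch_visit (F ! j)))" if "j < length F" for j
    unfolding W_def using dur sorted that by (intro sum_mono2) (auto simp: less_Suc_eq_le)
  define arr where "arr t = travel_time I vs t + W t" for t
  define dep where "dep t = travel_time I vs t + W (Suc t)" for t
  define lau where "lau d j = travel_time I vs (launch_visit (F ! j)) + sum dur {..<j}" for d j :: nat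
  define ret where "ret d j = travel_time I vs (launch_visit (F ! j)) + sum dur {..<Suc j}" for d j :: nat
  have d0: "d = 0" if "j < length (flights S ! d)" "d < length (flights S)" for d j
    using that by (cases d) (auto simp: S_def)
  have f0: "flights S ! 0 = F"
    by (simp add: S_def)
  have "schedule I S arr dep lau ret"
    unfolding schedule_def Let_def
  proof (intro conjI allI impI)
    show "arr 0 = 0"
      by (simp add: arr_def W_def travel_time_simps)
    show "arr t \<le> dep t" for t
      unfolding arr_def dep_def W_def using dur by (intro add_left_mono sum_mono2) auto
    show "arr (Suc t) = dep t + truck_time I (route S ! t) (route S ! Suc t)" for t
      by (simp add: arr_def dep_def travel_time_simps S_def)
  next
    fix d j assume dj: "d < length (flights S)" "j < length (flights S ! d)"
    then have d: "d = 0" and j: "j < length F"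
      using d0 f0 by auto
    have f: "flights S ! d ! j = F ! j"
      by (simp add: d f0)
    have ret_visit: "retrieve_visit (F ! j) = launch_visit (F ! j)"
      using F j by simp
    note bounds = W_le [OF j] W_ge [OF j] dur [of j]
    show "arr (launch_visit (flights S ! d ! j)) \<le> lau d j"
      "lau d j \<le> dep (launch_visit (flights S ! d ! j))"
      "lau d j + sortie_duration I (tour (flights S ! d ! j)) \<le> ret d j"
      "arr (retrieve_visit (flights S ! d ! j)) \<le> ret d j"
      "ret d j \<le> dep (retrieve_visit (flights S ! d ! j))"
      unfolding f ret_visit using bounds by (simp_all add: arr_def dep_def lau_def ret_def dur_def)
  next
    fix d j assume dj: "d < length (flights S)" "Suc j < length (flights S ! d)"
    then have "Suc j < length F"
      using d0 f0 by metis
    then show "ret d j \<le> lau d (Suc j)"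
      using travel_time_mono [OF I sorted [of j "Suc j"]] by (simp add: lau_def ret_def)
  qed
  then have "completion_time I S \<le> dep (length (route S) - 1)"
    by (rule completion_time_le [OF I S])
  also have "\<dots> = path_length (truck_time I) vs + W (length vs)"
    using vs by (simp add: dep_def S_def travel_time_def path_length_conv_sum truck_route_def)
  also have "W (length vs) = (\<Sum>j<length F. dur j)"
  proof -
    have "launch_visit (F ! j) < length vs" if "j < length F" for j
      using F [OF nth_mem [OF that]] by (simp add: feasible_flight_def)
    then show ?thesis
      unfolding W_def by (intro sum.cong) auto
  qed
  also have "\<dots> = sum_list (map (\<lambda>f. sortie_duration I (tour f)) F)"
    by (simp add: dur_def sum_list_sum_nth atLeast0LessThan)
  also have "\<dots> = sum_list (map (\<lambda>f. sortie_duration I (tour f)) (map fl L))"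
    by (simp only: F_def sum_list_map_sort_key)
  also have "\<dots> = sum_list (map (sortie_duration I) L)"
    by (simp add: comp_def fl_def)
  finally show ?thesis
    using S by (auto simp: S_def)
qed

section \<open>Comparing the two optima\<close>

lemma sum_list_concat_map_le:
  fixes g :: "'b \<Rightarrow> real"
  assumes "\<And>x. x \<in> set xs \<Longrightarrow> sum_list (map g (h x)) \<le> c * k x"
  shows "sum_list (map g (concat (map h xs))) \<le> c * sum_list (map k xs)"
  using assms by (induction xs) (auto simp: algebra_simps add_mono)

lemma m_CYCLE_le_schedule:
  assumes I: "tspd_instance I" and "0 \<le> c"
    and loops: "\<And>p. feasible_sortie I p \<Longrightarrow> \<exists>L. loops_for I p (c * sortie_duration I p) L"
    and S: "feasible_solution I S" and sch: "schedule I S arr dep lau ret"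
  shows "m_CYCLE I \<le> (1 + c * real (drones I)) * dep (length (route S) - 1)"
proof -
  let ?C = "dep (length (route S) - 1)"
  obtain h where h: "\<And>p. feasible_sortie I p \<Longrightarrow> loops_for I p (c * sortie_duration I p) (h p)"
    using loops by metis
  define fs where "fs = concat (flights S)"
  define L where "L = concat (map (h \<circ> tour) fs)"
  have fs: "feasible_flight I (route S) f" if "f \<in> set fs" for f
    using that S by (auto simp: fs_def feasible_solution_def)
  have hf: "loops_for I (tour f) (c * sortie_duration I (tour f)) (h (tour f))" if "f \<in> set fs" for f
    using fs [OF that] h by (simp add: feasible_flight_def)
  have ends: "hd (tour f) \<in> set (route S)" "last (tour f) \<in> set (route S)" if "f \<in> set fs" for f
    using fs [OF that] by (auto simp: feasible_flight_def)
  have "truck_route I (route S)"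
    using S by (simp add: feasible_solution_def)
  from ex_shortcut [OF I this] obtain us where us: "truck_route I us" "set us = set (route S)"
    "distinct (butlast us)"
    "path_length (truck_time I) us \<le> path_length (truck_time I) (route S)"
    by blast
  have "feasible_sortie I l \<and> is_loop l \<and> hd l \<in> set us" if "l \<in> set L" for l
    using that hf ends us(2) by (fastforce simp: L_def loops_for_def)
  moreover have "nodes I \<subseteq> set us \<union> (\<Union>l \<in> set L. served l)"
  proof
    fix x assume "x \<in> nodes I"
    \<comment> \<open>A node served by a sortie is either one of its end points, hence on the truck
      route, or served by one of the replacing loops.\<close>
    then consider "x \<in> set (route S)" | f where "f \<in> set fs" "x \<in> served (tour f)"
      using S by (fastforce simp: feasible_solution_def fs_def)
    then show "x \<in> set us \<union> (\<Union>l \<in> set L. served l)"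
    proof cases
      case (2 f)
      then have "x \<in> {hd (tour f), last (tour f)} \<union> (\<Union>l \<in> set (h (tour f)). served l)"
        using hf [of f] by (auto simp: loops_for_def)
      then show ?thesis
        using ends [of f] 2(1) us(2) by (auto simp: L_def)
    qed (use us in simp)
  qed
  ultimately obtain S' where S': "feasible_solution I S'" "route S' = us"
    "completion_time I S' \<le> path_length (truck_time I) us + sum_list (map (sortie_duration I) L)"
    using ex_loop_solution [OF I us(1)] by blast
  have "sum_list (map (sortie_duration I) L)
      \<le> c * sum_list (map (\<lambda>f. sortie_duration I (tour f)) fs)"
    unfolding L_def using hf by (intro sum_list_concat_map_le) (simp add: loops_for_def)
  moreover have "sum_list (map (\<lambda>f. sortie_duration I (tour f)) (concat Fs)) \<le> real (length Fs) * ?C"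
    if "set Fs \<subseteq> set (flights S)" for Fs
    using that
  proof (induction Fs)
    case (Cons F Fs)
    then show ?case
      using drone_time_le_schedule [OF I S sch, of F] by (simp add: distrib_right)
  qed simp
  from this [of "flights S"]
  have "sum_list (map (\<lambda>f. sortie_duration I (tour f)) fs) \<le> real (drones I) * ?C"
    using S by (simp add: fs_def feasible_solution_def)
  then have "c * sum_list (map (\<lambda>f. sortie_duration I (tour f)) fs) \<le> c * (real (drones I) * ?C)"
    using \<open>0 \<le> c\<close> by (rule mult_left_mono)
  moreover have "m_CYCLE I \<le> completion_time I S'"
    unfolding m_CYCLE_def
    using S' us(3) completion_time_ge [OF I, of _ 0] schedule_end_nonneg [OF I]
    by (intro cInf_lower bdd_belowI [of _ 0]) (auto simp: no_revisit_def)
  ultimately show ?thesis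
    using S'(3) us(4) path_length_le_schedule [OF I S sch] by (simp add: algebra_simps)
qed

text \<open>Dividing by the positive factor turns the claim into a lower bound for
  \<open>TSP_mD I\<close>, which passes through both nested infima.\<close>

lemma m_CYCLE_le_TSP_mD:
  assumes I: "tspd_instance I" and ex: "\<exists>S. feasible_solution I S" and "0 \<le> c"
    and loops: "\<And>p. feasible_sortie I p \<Longrightarrow> \<exists>L. loops_for I p (c * sortie_duration I p) L"
  shows "m_CYCLE I \<le> (1 + c * real (drones I)) * TSP_mD I"
proof -
  let ?k = "1 + c * real (drones I)"
  have k: "0 < ?k"
    using \<open>0 \<le> c\<close> by (simp add: add_pos_nonneg)
  have "m_CYCLE I / ?k \<le> TSP_mD I"
    unfolding TSP_mD_def
  proof (rule cInf_greatest)
    fix C assume "C \<in> completion_time I ` {S. feasible_solution I S}"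
    then obtain S where S: "feasible_solution I S" "C = completion_time I S"
      by blast
    show "m_CYCLE I / ?k \<le> C"
      unfolding S(2)
    proof (rule completion_time_ge [OF I S(1)])
      fix arr dep lau ret assume "schedule I S arr dep lau ret"
      from m_CYCLE_le_schedule [OF I \<open>0 \<le> c\<close> loops S(1) this]
      show "m_CYCLE I / ?k \<le> dep (length (route S) - 1)"
        using k by (simp add: pos_divide_le_eq mult.commute)
    qed
  qed (use ex in auto)
  then show ?thesis
    using k by (simp add: pos_divide_le_eq mult.commute)
qed

theorem proposition5p2:
  fixes I :: "'a tspd"
  assumes "tspd_instance I"
    and "\<exists>S. feasible_solution I S"
  shows "m_CYCLE I \<le> (1 + 2 * real (drones I)) * TSP_mD I \<and>
    ((\<forall>p. feasible_sortie I p \<longrightarrow> is_loop p \<or> card (served p) = 1) \<longrightarrow>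
       m_CYCLE I \<le> (1 + real (drones I)) * TSP_mD I)"
  using m_CYCLE_le_TSP_mD [OF assms, of 2] m_CYCLE_le_TSP_mD [OF assms, of 1]
    ex_loops_for_double [OF assms(1)] ex_loops_for_loop_or_single [OF assms(1)]
  by auto

end
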